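(* For all integers $k \geq 0$ and $n \geq 0$, the set of all planar rooted forests with $k+1$ trees and $n$ edges (in total) contains exactly $C^k_n$ elements.
   Context: Catalan numbers: $C_0 = 1$ and $C_{n+1} = \sum_{i=0}^n C_i C_{n-i}$ for $n \geq 0$. Self-convolutions: the convolution of two sequences $A = (A_n)_{n\ge 0}$ and $B = (B_n)_{n \ge 0}$ is $(A \ast B)_n = \sum_{m=0}^n A_m B_{n-m}$. For $k \geq 0$, $C^k$ denotes the sequence $C \ast \cdots \ast C$ with $k+1$ factors, where $C = (C_n)_{n\ge0}$; in particular $C^0 = C$ and $C^1 = C \ast C$. Its $n$th term is denoted $C^k_n$. Planar rooted forests: a rooted tree is a (finite) tree with a specified vertex called the root; a single vertex with no edges is allowed. A planar rooted tree is a rooted tree in which the children of each vertex carry a left-to-right linear order, and planar rooted trees are considered up to isomorphism preserving the root and these orders. A planar rooted forest with $k+1$ trees is a collection of $k+1$ planar rooted trees given in a specified order, i.e. an ordered $(k+1)$-tuple of planar rooted trees (repetitions allowed; the order of the trees matters). Its number of edges is the total number of edges of its trees. *)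

theory Defs
  imports Main
begin

section \<open>Catalan numbers and convolutions\<close>

fun catalan :: "nat \<Rightarrow> nat" where
  "catalan 0 = 1"
| "catalan (Suc n) = (\<Sum>i\<le>n. catalan i * catalan (n - i))"

definition convolution :: "(nat \<Rightarrow> nat) \<Rightarrow> (nat \<Rightarrow> nat) \<Rightarrow> nat \<Rightarrow> nat" where
  "convolution A B n = (\<Sum>m\<le>n. A m * B (n - m))"

text \<open>The index is shifted: \<open>self_convolution A k\<close> has \<open>k + 1\<close> factors.\<close>

fun self_convolution :: "(nat \<Rightarrow> nat) \<Rightarrow> nat \<Rightarrow> nat \<Rightarrow> nat" where
  "self_convolution A 0 = A"
| "self_convolution A (Suc k) = convolution A (self_convolution A k)"

section \<open>Trees\<close>

text \<open>Simple undirected graphs: an edge is a two-element set of vertices. Walks and paths are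
  given by their nonempty vertex sequences.\<close>

definition is_graph :: "'a set \<Rightarrow> 'a set set \<Rightarrow> bool" where
  "is_graph V E \<longleftrightarrow> (\<forall>e\<in>E. e \<subseteq> V \<and> card e = 2)"

definition is_walk :: "'a set \<Rightarrow> 'a set set \<Rightarrow> 'a list \<Rightarrow> bool" where
  "is_walk V E p \<longleftrightarrow> p \<noteq> [] \<and> set p \<subseteq> V \<and> successively (\<lambda>u v. {u, v} \<in> E) p"

definition is_path :: "'a set \<Rightarrow> 'a set set \<Rightarrow> 'a list \<Rightarrow> bool" where
  "is_path V E p \<longleftrightarrow> is_walk V E p \<and> distinct p"

definition is_cycle :: "'a set \<Rightarrow> 'a set set \<Rightarrow> 'a list \<Rightarrow> bool" where
  "is_cycle V E p \<longleftrightarrow> is_path V E p \<and> length p \<ge> 3 \<and> {last p, hd p} \<in> E"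

definition is_connected :: "'a set \<Rightarrow> 'a set set \<Rightarrow> bool" where
  "is_connected V E \<longleftrightarrow>
     V \<noteq> {} \<and> (\<forall>u\<in>V. \<forall>v\<in>V. \<exists>p. is_walk V E p \<and> hd p = u \<and> last p = v)"

definition is_tree :: "'a set \<Rightarrow> 'a set set \<Rightarrow> bool" where
  "is_tree V E \<longleftrightarrow> is_graph V E \<and> finite V \<and> is_connected V E \<and> (\<nexists>p. is_cycle V E p)"

section \<open>Planar rooted trees\<close>

text \<open>The list \<open>kids T v\<close> enumerates the children of \<open>v\<close> from left to right; its values outside
  the vertex set are irrelevant.\<close>

record 'a tree_data =
  verts :: "'a set"
  edges :: "'a set set"
  root :: 'a
  kids :: "'a \<Rightarrow> 'a list"

text \<open>\<open>w\<close> is a child of \<open>v\<close> iff \<open>v\<close> is the last vertex before \<open>w\<close> on the path from the root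
  to \<open>w\<close>.\<close>

definition is_child :: "'a tree_data \<Rightarrow> 'a \<Rightarrow> 'a \<Rightarrow> bool" where
  "is_child T v w \<longleftrightarrow>
     (\<exists>p. is_path (verts T) (edges T) (p @ [v, w]) \<and> hd (p @ [v, w]) = root T)"

definition is_planar_rooted_tree :: "'a tree_data \<Rightarrow> bool" where
  "is_planar_rooted_tree T \<longleftrightarrow>
     is_tree (verts T) (edges T) \<and> root T \<in> verts T \<and>
     (\<forall>v\<in>verts T. distinct (kids T v) \<and> set (kids T v) = {w. is_child T v w})"

definition is_iso :: "('a \<Rightarrow> 'b) \<Rightarrow> 'a tree_data \<Rightarrow> 'b tree_data \<Rightarrow> bool" where
  "is_iso f S T \<longleftrightarrow>
     bij_betw f (verts S) (verts T) \<and>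
     (\<forall>u\<in>verts S. \<forall>v\<in>verts S. {u, v} \<in> edges S \<longleftrightarrow> {f u, f v} \<in> edges T) \<and>
     f (root S) = root T \<and>
     (\<forall>v\<in>verts S. map f (kids S v) = kids T (f v))"

definition isomorphic :: "'a tree_data \<Rightarrow> 'b tree_data \<Rightarrow> bool" where
  "isomorphic S T \<longleftrightarrow>
     is_planar_rooted_tree S \<and> is_planar_rooted_tree T \<and> (\<exists>f. is_iso f S T)"

lemma kids_in_verts:
  assumes "is_planar_rooted_tree T" "v \<in> verts T"
  shows "set (kids T v) \<subseteq> verts T"
  using assms by (auto simp: is_planar_rooted_tree_def is_child_def is_path_def is_walk_def)

lemma isomorphic_refl:
  assumes "is_planar_rooted_tree T"
  shows "isomorphic T T"
proof -
  have "is_iso id T T" by (simp add: is_iso_def)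
  then show ?thesis using assms unfolding isomorphic_def by blast
qed

lemma isomorphic_sym:
  assumes "isomorphic S T"
  shows "isomorphic T S"
proof -
  from assms obtain f where S: "is_planar_rooted_tree S" and T: "is_planar_rooted_tree T"
    and f: "bij_betw f (verts S) (verts T)"
    and e: "\<And>u v. u \<in> verts S \<Longrightarrow> v \<in> verts S \<Longrightarrow> {u, v} \<in> edges S \<longleftrightarrow> {f u, f v} \<in> edges T"
    and r: "f (root S) = root T"
    and k: "\<And>v. v \<in> verts S \<Longrightarrow> map f (kids S v) = kids T (f v)"
    unfolding isomorphic_def is_iso_def by auto
  define g where "g = inv_into (verts S) f"
  have g: "bij_betw g (verts T) (verts S)"
    unfolding g_def by (rule bij_betw_inv_into[OF f])
  have fg: "f (g y) = y" if "y \<in> verts T" for y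
    unfolding g_def using bij_betw_inv_into_right[OF f that] .
  have gf: "g (f x) = x" if "x \<in> verts S" for x
    unfolding g_def using bij_betw_inv_into_left[OF f that] .
  have gV: "g y \<in> verts S" if "y \<in> verts T" for y
    using g that by (auto simp: bij_betw_def)
  have "is_iso g T S"
    unfolding is_iso_def
  proof (intro conjI ballI)
    show "bij_betw g (verts T) (verts S)" by fact
    show "{u, v} \<in> edges T \<longleftrightarrow> {g u, g v} \<in> edges S" if "u \<in> verts T" "v \<in> verts T" for u v
      using e[OF gV gV] fg that by simp
    show "g (root T) = root S"
      using gf[of "root S"] r S by (simp add: is_planar_rooted_tree_def)
    show "map g (kids T v) = kids S (g v)" if v: "v \<in> verts T" for v
    proof -
      have "kids T v = map f (kids S (g v))" using k[OF gV[OF v]] fg[OF v] by simp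
      moreover have "map g (map f (kids S (g v))) = kids S (g v)"
        using kids_in_verts[OF S gV[OF v]] gf by (auto intro!: map_idI)
      ultimately show ?thesis by simp
    qed
  qed
  then show ?thesis using S T unfolding isomorphic_def by blast
qed

lemma isomorphic_trans:
  assumes "isomorphic S T" "isomorphic T U"
  shows "isomorphic S U"
proof -
  from assms obtain f g where f: "is_iso f S T" and g: "is_iso g T U"
    and S: "is_planar_rooted_tree S" and U: "is_planar_rooted_tree U"
    unfolding isomorphic_def by auto
  have fV: "f x \<in> verts T" if "x \<in> verts S" for x
    using f that by (auto simp: is_iso_def bij_betw_def)
  have "is_iso (g \<circ> f) S U"
    unfolding is_iso_def
  proof (intro conjI ballI)
    show "bij_betw (g \<circ> f) (verts S) (verts U)"
      using f g bij_betw_trans[of f "verts S" "verts T" g "verts U"] by (simp add: is_iso_def)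
    show "{u, v} \<in> edges S \<longleftrightarrow> {(g \<circ> f) u, (g \<circ> f) v} \<in> edges U"
      if "u \<in> verts S" "v \<in> verts S" for u v
      using f g that fV by (simp add: is_iso_def)
    show "(g \<circ> f) (root S) = root U" using f g by (simp add: is_iso_def)
    show "map (g \<circ> f) (kids S v) = kids U ((g \<circ> f) v)" if v: "v \<in> verts S" for v
    proof -
      have "map g (map f (kids S v)) = kids U (g (f v))"
        using f g v fV by (simp add: is_iso_def del: map_map)
      then show ?thesis by simp
    qed
  qed
  then show ?thesis using S U unfolding isomorphic_def by blast
qed

lemma single_vertex_tree:
  "is_planar_rooted_tree \<lparr>verts = {x}, edges = {}, root = x, kids = (\<lambda>_. [])\<rparr>"
proof -
  have "is_walk {x} {} [x]"
    by (simp add: is_walk_def)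
  then have "is_connected {x} {}"
    unfolding is_connected_def by force
  then have "is_tree {x} {}"
    by (simp add: is_tree_def is_graph_def is_cycle_def)
  moreover have "\<not> is_path {x} {} (p @ [v, w])" for p v w
    by (simp add: is_path_def is_walk_def successively_append_iff)
  ultimately show ?thesis
    by (simp add: is_planar_rooted_tree_def is_child_def)
qed

text \<open>A planar rooted tree is an isomorphism class. Taking the vertices to be natural numbers is
  no restriction, since trees are finite.\<close>

quotient_type planar_tree = "nat tree_data" / partial: isomorphic
proof (rule part_equivpI)
  show "\<exists>T::nat tree_data. isomorphic T T"
    by (rule exI) (rule isomorphic_refl[OF single_vertex_tree])
  show "symp (isomorphic :: nat tree_data \<Rightarrow> _)"
    by (rule sympI) (rule isomorphic_sym)
  show "transp (isomorphic :: nat tree_data \<Rightarrow> _)"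
    by (rule transpI) (rule isomorphic_trans)
qed

lemma is_graph_edgeE:
  assumes "is_graph V E" "e \<in> E"
  obtains u v where "e = {u, v}" "u \<in> V" "v \<in> V"
proof -
  have "card e = 2" "e \<subseteq> V" using assms by (simp_all add: is_graph_def)
  then obtain u v where "e = {u, v}" by (auto simp: card_2_iff)
  with \<open>e \<subseteq> V\<close> show thesis using that by simp
qed

lemma isomorphic_edges_image:
  assumes "is_planar_rooted_tree S" "is_planar_rooted_tree T" "is_iso f S T"
  shows "edges T = image f ` edges S"
proof -
  have gS: "is_graph (verts S) (edges S)" and gT: "is_graph (verts T) (edges T)"
    using assms by (simp_all add: is_planar_rooted_tree_def is_tree_def)
  have fV: "verts T = f ` verts S" using assms by (simp add: is_iso_def bij_betw_def)
  have e: "{u, v} \<in> edges S \<longleftrightarrow> {f u, f v} \<in> edges T" if "u \<in> verts S" "v \<in> verts S" for u v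
    using assms that by (simp add: is_iso_def)
  show ?thesis
  proof (intro equalityI subsetI)
    fix d assume d: "d \<in> edges T"
    obtain a b where ab: "d = {a, b}" "a \<in> verts T" "b \<in> verts T"
      by (rule is_graph_edgeE[OF gT d])
    obtain u where u: "u \<in> verts S" "a = f u" using ab(2) unfolding fV by (rule imageE)
    obtain v where v: "v \<in> verts S" "b = f v" using ab(3) unfolding fV by (rule imageE)
    have "{u, v} \<in> edges S" using e[OF u(1) v(1)] d ab(1) u(2) v(2) by simp
    moreover have "d = f ` {u, v}" using ab(1) u(2) v(2) by simp
    ultimately show "d \<in> image f ` edges S" by (rule rev_image_eqI)
  next
    fix d assume "d \<in> image f ` edges S"
    then obtain c where c: "c \<in> edges S" "d = f ` c" by blast
    obtain u v where uv: "c = {u, v}" "u \<in> verts S" "v \<in> verts S"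
      by (rule is_graph_edgeE[OF gS c(1)])
    show "d \<in> edges T" using e[OF uv(2,3)] c uv(1) by simp
  qed
qed

lift_definition num_edges :: "planar_tree \<Rightarrow> nat" is "\<lambda>T. card (edges T)"
proof -
  fix S T :: "nat tree_data"
  assume "isomorphic S T"
  then obtain f where S: "is_planar_rooted_tree S" and T: "is_planar_rooted_tree T"
    and f: "is_iso f S T"
    unfolding isomorphic_def by blast
  have "inj_on f (verts S)" using f by (simp add: is_iso_def bij_betw_def)
  moreover have "edges S \<subseteq> Pow (verts S)"
    using S by (auto simp: is_planar_rooted_tree_def is_tree_def is_graph_def)
  ultimately have "inj_on (image f) (edges S)"
    by (meson inj_on_image_Pow inj_on_subset)
  then show "card (edges S) = card (edges T)"
    using isomorphic_edges_image[OF S T f] by (simp add: card_image)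
qed

definition planar_forests :: "nat \<Rightarrow> nat \<Rightarrow> planar_tree list set" where
  "planar_forests m n = {F. length F = m \<and> (\<Sum>T\<leftarrow>F. num_edges T) = n}"

end

theory Submission
  imports Defs "HOL-Library.Nat_Bijection"
begin

text \<open>A planar rooted tree is determined up to isomorphism by the plane tree read off from its
  lists of children, and every plane tree is read off from the tree whose vertices are the addresses
  of its nodes. For this, acyclicity and connectedness are traded for two local conditions (unique
  parents, and a depth that grows by one along each edge). Removing the leftmost subtree of the root
  gives the Catalan recursion for plane trees, and removing the first tree of a forest gives the
  convolution.\<close>

section \<open>Walks and paths\<close>

text \<open>Two definitions stand in the way of a direct count: children are described through the
  existence of root paths, and a planar tree is a class of a partial quotient. The assumptions of
  the locale \<open>graded_tree\<close> avoid paths altogether, and a suitable depth makes both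
  canonical and arbitrary planar rooted trees satisfy them. For the quotient, a complete invariant
  of isomorphism classes is needed. The labels come from a recursion over the child lists, which has
  exactly one solution on the vertices of a graded tree. Isomorphisms must therefore respect them,
  and the label of the root is the invariant.\<close>

lemma is_walk_append_iff:
  assumes "p \<noteq> []" "q \<noteq> []"
  shows "is_walk V E (p @ q) \<longleftrightarrow> is_walk V E p \<and> is_walk V E q \<and> {last p, hd q} \<in> E"
  using assms by (auto simp: is_walk_def successively_append_iff)

lemma is_walk_Cons:
  assumes "q \<noteq> []"
  shows "is_walk V E (x # q) \<longleftrightarrow> x \<in> V \<and> is_walk V E q \<and> {x, hd q} \<in> E"
  using assms by (auto simp: is_walk_def successively_Cons)

lemma is_walk_singleton [simp]: "is_walk V E [x] \<longleftrightarrow> x \<in> V"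
  by (simp add: is_walk_def)

lemma is_walk_rev:
  assumes "is_walk V E p"
  shows "is_walk V E (rev p)"
  using assms by (simp add: is_walk_def insert_commute)

text \<open>The shared vertex will be the root: a walk from the root, reversed, is continued by
  another walk from the root.\<close>

lemma is_walk_join:
  assumes "is_walk V E p" "is_walk V E q" "last p = hd q"
  shows "is_walk V E (p @ tl q)" "hd (p @ tl q) = hd p" "last (p @ tl q) = last q"
proof -
  have p: "p \<noteq> []" and "q \<noteq> []" using assms by (auto simp: is_walk_def)
  then obtain y q' where q: "q = y # q'" by (cases q) auto
  show "is_walk V E (p @ tl q)"
    using assms p by (cases "q' = []") (auto simp: q is_walk_append_iff is_walk_Cons)
  show "hd (p @ tl q) = hd p" "last (p @ tl q) = last q"
    using assms p by (auto simp: q)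
qed

text \<open>Loop erasure from the front: if the new first vertex already lies on the path found for
  the rest, only the part from that occurrence on is kept.\<close>

lemma is_walk_imp_is_path:
  assumes "is_walk V E p"
  obtains q where "is_path V E q" "hd q = hd p" "last q = last p" "set q \<subseteq> set p"
proof -
  have "\<exists>q. is_path V E q \<and> hd q = hd p \<and> last q = last p \<and> set q \<subseteq> set p"
    using assms
  proof (induction p)
    case Nil
    then show ?case by (simp add: is_walk_def)
  next
    case (Cons x p)
    show ?case
    proof (cases "p = []")
      case True
      then show ?thesis using Cons.prems by (intro exI[of _ "[x]"]) (simp add: is_path_def)
    next
      case False
      then have w: "x \<in> V" "is_walk V E p" "{x, hd p} \<in> E"
        using Cons.prems by (simp_all add: is_walk_Cons)
      then obtain q where q: "is_path V E q" "hd q = hd p" "last q = last p" "set q \<subseteq> set p"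
        using Cons.IH by blast
      have ne: "q \<noteq> []" using q(1) by (simp add: is_path_def is_walk_def)
      show ?thesis
      proof (cases "x \<in> set q")
        case True
        then obtain a b where ab: "q = a @ x # b" by (meson split_list)
        have "is_path V E (x # b)"
          using q(1) by (cases "a = []") (auto simp: ab is_path_def is_walk_append_iff)
        then show ?thesis
          using q False by (intro exI[of _ "x # b"]) (auto simp: ab)
      next
        case x: False
        then show ?thesis
          using q w ne False
          by (intro exI[of _ "x # q"]) (auto simp: is_path_def is_walk_Cons)
      qed
    qed
  qed
  then show thesis using that by blast
qed

lemma is_path_snoc:
  assumes "is_path V E (p @ [v])" "{v, w} \<in> E" "w \<in> V" "w \<notin> set (p @ [v])"
  shows "is_path V E (p @ [v, w])"
  using assms by (auto simp: is_path_def is_walk_def successively_append_iff)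

text \<open>Allows a cycle to be started at a vertex of greatest depth.\<close>

lemma is_cycle_rotate:
  assumes "is_cycle V E (a @ x # b)"
  shows "is_cycle V E (x # b @ a)"
proof (cases "a = []")
  case True
  then show ?thesis using assms by simp
next
  case False
  then have "is_walk V E a" "is_walk V E (x # b)" "{last a, x} \<in> E"
      "{last (x # b), hd a} \<in> E" "distinct (x # b @ a)" "length (x # b @ a) \<ge> 3"
    using assms by (auto simp: is_cycle_def is_path_def is_walk_append_iff)
  then show ?thesis
    using False is_walk_append_iff[of "x # b" a V E]
    by (simp add: is_cycle_def is_path_def)
qed

section \<open>Planar rooted trees as graded structures\<close>

text \<open>The depth is a parameter because each source of trees brings its own: the address length
  for canonical trees, the number of edges on the root path for given ones. That the root has no
  parent follows from \<open>depth_root\<close> and \<open>depth_kid\<close>.\<close>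

locale graded_tree =
  fixes T :: "'a tree_data" and d :: "'a \<Rightarrow> nat"
  assumes finite_verts: "finite (verts T)"
    and root_in_verts: "root T \<in> verts T"
    and depth_root: "d (root T) = 0"
    and distinct_kids: "v \<in> verts T \<Longrightarrow> distinct (kids T v)"
    and kid_in_verts: "v \<in> verts T \<Longrightarrow> w \<in> set (kids T v) \<Longrightarrow> w \<in> verts T"
    and depth_kid: "v \<in> verts T \<Longrightarrow> w \<in> set (kids T v) \<Longrightarrow> d w = Suc (d v)"
    and parent_unique: "u \<in> verts T \<Longrightarrow> v \<in> verts T \<Longrightarrow> w \<in> set (kids T u) \<Longrightarrow>
      w \<in> set (kids T v) \<Longrightarrow> u = v"
    and parent_exists: "w \<in> verts T \<Longrightarrow> w \<noteq> root T \<Longrightarrow> \<exists>v\<in>verts T. w \<in> set (kids T v)"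
    and edges_eq: "edges T = {{v, w} | v w. v \<in> verts T \<and> w \<in> set (kids T v)}"
begin

lemma edge_iff:
  assumes "u \<in> verts T" "v \<in> verts T"
  shows "{u, v} \<in> edges T \<longleftrightarrow> v \<in> set (kids T u) \<or> u \<in> set (kids T v)"
  using assms by (auto simp: edges_eq doubleton_eq_iff)

lemma root_induct [consumes 1, case_names root kid]:
  assumes "v \<in> verts T" "P (root T)"
    and "\<And>v w. v \<in> verts T \<Longrightarrow> w \<in> set (kids T v) \<Longrightarrow> P v \<Longrightarrow> P w"
  shows "P v"
  using assms(1)
proof (induction "d v" arbitrary: v rule: less_induct)
  case less
  show ?case
  proof (cases "v = root T")
    case False
    then obtain u where "u \<in> verts T" "v \<in> set (kids T u)"
      using parent_exists less.prems by blast
    then show ?thesis using less.hyps[of u] depth_kid assms(3) by auto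
  qed (use assms(2) in simp)
qed

text \<open>The gap between the depth of a vertex and the greatest depth in the tree shrinks from a
  vertex to its children.\<close>

lemma leaf_induct [consumes 1, case_names vert]:
  assumes "v \<in> verts T"
    and step: "\<And>v. v \<in> verts T \<Longrightarrow> (\<And>w. w \<in> set (kids T v) \<Longrightarrow> P w) \<Longrightarrow> P v"
  shows "P v"
  using assms(1)
proof (induction "Max (d ` verts T) - d v" arbitrary: v rule: less_induct)
  case less
  show ?case
  proof (rule step[OF less.prems])
    fix w assume w: "w \<in> set (kids T v)"
    have "d w \<le> Max (d ` verts T)"
      using kid_in_verts[OF less.prems w] finite_verts by simp
    then show "P w"
      using less.hyps[of w] kid_in_verts[OF less.prems w] depth_kid[OF less.prems w] by simp
  qed
qed

text \<open>The depth bound strengthens the induction: a child is deeper than every vertex on the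
  path so far, so appending it keeps the path distinct.\<close>

lemma root_path_exists:
  assumes "v \<in> verts T"
  shows "\<exists>p. is_path (verts T) (edges T) (p @ [v]) \<and> hd (p @ [v]) = root T \<and>
    (\<forall>x\<in>set (p @ [v]). d x \<le> d v)"
  using assms
proof (induction rule: root_induct)
  case root
  show ?case by (rule exI[of _ "[]"]) (simp add: is_path_def root_in_verts)
next
  case (kid v w)
  then obtain p where p: "is_path (verts T) (edges T) (p @ [v])" "hd (p @ [v]) = root T"
    "\<forall>x\<in>set (p @ [v]). d x \<le> d v" by blast
  have dw: "d w = Suc (d v)" "w \<in> verts T" using kid depth_kid kid_in_verts by auto
  then have "w \<notin> set (p @ [v])" using p(3) by fastforce
  moreover have "{v, w} \<in> edges T" using kid dw edge_iff by blast
  ultimately have "is_path (verts T) (edges T) (p @ [v, w])"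
    using p(1) dw(2) is_path_snoc by metis
  then show ?case
    using p(2,3) dw(1) by (intro exI[of _ "p @ [v]"]) (auto simp: hd_append)
qed

text \<open>A step upwards is impossible: at the root by its depth, and elsewhere because it would
  return to the unique parent, from which the path has just come.\<close>

lemma root_path_descends:
  assumes "is_path (verts T) (edges T) p" "hd p = root T"
  shows "successively (\<lambda>v w. w \<in> set (kids T v)) p"
  using assms
proof (induction p rule: rev_induct)
  case (snoc w p)
  show ?case
  proof (cases p rule: rev_cases)
    case (snoc q v)
    have path: "is_path (verts T) (edges T) (q @ [v])"
      and in_verts: "set (q @ [v, w]) \<subseteq> verts T" and e: "{v, w} \<in> edges T"
      and "distinct (q @ [v, w])"
      using \<open>is_path _ _ (p @ [w])\<close> is_walk_append_iff[of "q @ [v]" "[w]" "verts T" "edges T"]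
      by (auto simp: snoc is_path_def is_walk_def)
    have hd: "hd (q @ [v]) = root T"
      using \<open>hd (p @ [w]) = root T\<close> by (simp add: snoc hd_append split: if_splits)
    have desc: "successively (\<lambda>v w. w \<in> set (kids T v)) (q @ [v])"
      using snoc.IH path hd by (simp add: snoc)
    have "v \<notin> set (kids T w)"
    proof
      assume v: "v \<in> set (kids T w)"
      show False
      proof (cases q rule: rev_cases)
        case Nil
        then show False using v hd depth_root depth_kid[of w v] in_verts by simp
      next
        case (snoc q' u)
        then have "v \<in> set (kids T u)" using desc by (simp add: successively_append_iff)
        then have "u = w" using v parent_unique[of u w v] in_verts by (simp add: snoc)
        then show False using \<open>distinct (q @ [v, w])\<close> by (simp add: snoc)
      qed
    qed
    then have "w \<in> set (kids T v)" using e in_verts edge_iff by auto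
    then show ?thesis using desc by (simp add: snoc successively_append_iff)
  qed simp
qed simp

lemma is_child_iff:
  assumes "v \<in> verts T"
  shows "is_child T v w \<longleftrightarrow> w \<in> set (kids T v)"
proof
  assume "is_child T v w"
  then obtain p where "is_path (verts T) (edges T) (p @ [v, w])" "hd (p @ [v, w]) = root T"
    by (auto simp: is_child_def)
  then show "w \<in> set (kids T v)"
    using root_path_descends[of "p @ [v, w]"] by (simp add: successively_append_iff)
next
  assume w: "w \<in> set (kids T v)"
  obtain p where p: "is_path (verts T) (edges T) (p @ [v])" "hd (p @ [v]) = root T"
    "\<forall>x\<in>set (p @ [v]). d x \<le> d v" using root_path_exists assms by blast
  have dw: "d w = Suc (d v)" "w \<in> verts T" using assms w depth_kid kid_in_verts by auto
  then have "w \<notin> set (p @ [v])" using p(3) by fastforce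
  moreover have "{v, w} \<in> edges T" using assms w dw edge_iff by blast
  ultimately have "is_path (verts T) (edges T) (p @ [v, w])"
    using p(1) dw(2) is_path_snoc by metis
  moreover have "hd (p @ [v, w]) = root T" using p(2) by (cases p) simp_all
  ultimately show "is_child T v w" unfolding is_child_def by blast
qed

text \<open>A deepest vertex of a cycle has two distinct neighbours on it, as the length is at least
  3. Neither is deeper, so neither is a child, and both would be parents of that vertex.\<close>

lemma no_cycle: "\<not> is_cycle (verts T) (edges T) p"
proof
  assume c: "is_cycle (verts T) (edges T) p"
  then have "p \<noteq> []" by (auto simp: is_cycle_def)
  then have "Max (d ` set p) \<in> d ` set p" by (intro Max_in) auto
  then obtain x where x: "x \<in> set p" "d x = Max (d ` set p)" by auto
  then have x_max: "d y \<le> d x" if "y \<in> set p" for y using that by simp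
  obtain a b where ab: "p = a @ x # b" using x(1) by (meson split_list)
  have c': "is_cycle (verts T) (edges T) (x # b @ a)"
    using is_cycle_rotate c ab by metis
  obtain y q where yq: "b @ a = y # q" using c' by (cases "b @ a") (auto simp: is_cycle_def)
  define z where "z = last (y # q)"
  have "q \<noteq> []" using c' by (auto simp: is_cycle_def yq)
  then have z: "z \<in> set q" by (simp add: z_def)
  have cyc: "is_cycle (verts T) (edges T) (x # y # q)" using c' by (simp add: yq)
  have e: "{x, y} \<in> edges T" "{z, x} \<in> edges T"
    using cyc by (auto simp: is_cycle_def is_path_def is_walk_def z_def)
  have V: "x \<in> verts T" "y \<in> verts T" "z \<in> verts T" and "y \<noteq> z"
    using cyc z by (auto simp: is_cycle_def is_path_def is_walk_def)
  have "set (b @ a) = set (y # q)" by (simp only: yq)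
  then have "set p = set (x # y # q)" by (auto simp: ab)
  then have "d y \<le> d x" "d z \<le> d x" using x_max z by auto
  then have "y \<notin> set (kids T x)" "z \<notin> set (kids T x)" using V depth_kid by fastforce+
  then have "x \<in> set (kids T y)" "x \<in> set (kids T z)" using e V edge_iff by blast+
  then show False using parent_unique V \<open>y \<noteq> z\<close> by blast
qed

lemma planar_rooted_tree: "is_planar_rooted_tree T"
proof -
  have "is_graph (verts T) (edges T)"
    unfolding is_graph_def
  proof
    fix e assume "e \<in> edges T"
    then obtain v w where e: "e = {v, w}" "v \<in> verts T" "w \<in> set (kids T v)"
      by (auto simp: edges_eq)
    then have "d w = Suc (d v)" "w \<in> verts T" using depth_kid kid_in_verts by blast+
    then show "e \<subseteq> verts T \<and> card e = 2" using e by (cases "v = w") auto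
  qed
  moreover have "is_connected (verts T) (edges T)"
    unfolding is_connected_def
  proof (intro conjI ballI)
    show "verts T \<noteq> {}" using root_in_verts by blast
    fix u v assume "u \<in> verts T" "v \<in> verts T"
    then obtain p q where p: "is_walk (verts T) (edges T) (p @ [u])" "hd (p @ [u]) = root T"
      and q: "is_walk (verts T) (edges T) (q @ [v])" "hd (q @ [v]) = root T"
      using root_path_exists unfolding is_path_def by meson
    have "last (rev (p @ [u])) = hd (q @ [v])" using p(2) q(2) by (simp only: last_rev)
    note join = is_walk_join[OF is_walk_rev[OF p(1)] q(1) this]
    have "hd (rev (p @ [u]) @ tl (q @ [v])) = u" "last (rev (p @ [u]) @ tl (q @ [v])) = v"
      unfolding join(2,3) by simp_all
    with join(1) show "\<exists>p. is_walk (verts T) (edges T) p \<and> hd p = u \<and> last p = v"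
      by blast
  qed
  ultimately show ?thesis
    using finite_verts root_in_verts
    by (simp add: is_planar_rooted_tree_def is_tree_def no_cycle distinct_kids is_child_iff)
qed

text \<open>Each vertex other than the root is matched with the edge to its parent.\<close>

lemma card_edges: "Suc (card (edges T)) = card (verts T)"
proof -
  define par where "par w = (SOME v. v \<in> verts T \<and> w \<in> set (kids T v))" for w
  have par: "par w \<in> verts T" "w \<in> set (kids T (par w))" if "w \<in> verts T - {root T}" for w
  proof -
    have "\<exists>v. v \<in> verts T \<and> w \<in> set (kids T v)" using parent_exists that by blast
    from someI_ex[OF this] show "par w \<in> verts T" "w \<in> set (kids T (par w))"
      by (simp_all add: par_def)
  qed
  have "bij_betw (\<lambda>w. {par w, w}) (verts T - {root T}) (edges T)"
    unfolding bij_betw_def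
  proof
    show "inj_on (\<lambda>w. {par w, w}) (verts T - {root T})"
    proof (rule inj_onI)
      fix v w assume v: "v \<in> verts T - {root T}" and w: "w \<in> verts T - {root T}"
        and eq: "{par v, v} = {par w, w}"
      \<comment> \<open>These depths exclude the crossed case \<open>par v = w\<close>,
        \<open>par w = v\<close>, where each end would be deeper than the other.\<close>
      have "d v = Suc (d (par v))" "d w = Suc (d (par w))" using par v w depth_kid by blast+
      then show "v = w" using eq by (auto simp: doubleton_eq_iff)
    qed
    show "(\<lambda>w. {par w, w}) ` (verts T - {root T}) = edges T"
    proof (intro equalityI subsetI)
      fix e assume "e \<in> edges T"
      then obtain v w where e: "e = {v, w}" "v \<in> verts T" "w \<in> set (kids T v)"
        by (auto simp: edges_eq)
      then have w: "w \<in> verts T - {root T}" using kid_in_verts depth_kid depth_root by fastforce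
      then have "par w = v" using par e parent_unique by blast
      then show "e \<in> (\<lambda>w. {par w, w}) ` (verts T - {root T})" using w e by blast
    qed (use par in \<open>auto simp: edges_eq\<close>)
  qed
  then have "card (edges T) = card (verts T - {root T})" by (simp add: bij_betw_same_card)
  then show ?thesis using finite_verts root_in_verts by (simp only: card_Suc_Diff1)
qed

end

text \<open>Adjacency in a graded tree means that one end is a child of the other, so the edge
  clause of \<open>is_iso\<close> follows from the child lists.\<close>

lemma is_iso_graded_treeI:
  assumes "graded_tree S d" "graded_tree T d'"
    and f: "bij_betw f (verts S) (verts T)" "f (root S) = root T"
    and kids: "\<And>v. v \<in> verts S \<Longrightarrow> map f (kids S v) = kids T (f v)"
  shows "is_iso f S T"
proof -
  interpret S: graded_tree S d by fact
  interpret T: graded_tree T d' by fact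
  have inj: "inj_on f (verts S)" and V: "f ` verts S = verts T"
    using f by (auto simp: bij_betw_def)
  have kid: "f w \<in> set (kids T (f v)) \<longleftrightarrow> w \<in> set (kids S v)"
    if "v \<in> verts S" "w \<in> verts S" for v w
  proof -
    have "set (kids T (f v)) = f ` set (kids S v)" using kids[OF that(1)] by (metis list.set_map)
    then show ?thesis
      using inj_on_image_mem_iff[OF inj that(2)] S.kid_in_verts[OF that(1)] by (metis subsetI)
  qed
  have "{u, v} \<in> edges S \<longleftrightarrow> {f u, f v} \<in> edges T" if "u \<in> verts S" "v \<in> verts S" for u v
    using that S.edge_iff T.edge_iff V kid by blast
  then show ?thesis using f kids by (simp add: is_iso_def)
qed

section \<open>Every planar rooted tree is graded\<close>

text \<open>Take a path from the root to \<open>u\<close>. If it misses \<open>v\<close>, the edge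
  extends it to \<open>v\<close>. If it meets \<open>v\<close>, the part from \<open>v\<close> to
  \<open>u\<close> is closed by the edge to a cycle unless \<open>v\<close> comes directly before
  \<open>u\<close>.\<close>

lemma planar_rooted_tree_edge_cases:
  assumes T: "is_planar_rooted_tree T" and e: "{u, v} \<in> edges T"
  shows "is_child T u v \<or> is_child T v u"
proof -
  let ?V = "verts T" and ?E = "edges T"
  have uv: "u \<in> ?V" "v \<in> ?V" "u \<noteq> v"
    using T e by (auto simp: is_planar_rooted_tree_def is_tree_def is_graph_def)
  then obtain w where "is_walk ?V ?E w" "hd w = root T" "last w = u"
    using T unfolding is_planar_rooted_tree_def is_tree_def is_connected_def by blast
  then obtain p where p: "is_path ?V ?E p" "hd p = root T" "last p = u"
    by (metis is_walk_imp_is_path)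
  then obtain q where q: "p = q @ [u]"
    by (metis append_butlast_last_id is_path_def is_walk_def)
  show ?thesis
  proof (cases "v \<in> set p")
    case False
    then have "is_path ?V ?E (q @ [u, v])"
      using p(1) e uv is_path_snoc unfolding q by metis
    moreover have "hd (q @ [u, v]) = root T" using p(2) by (cases q) (simp_all add: q)
    ultimately show ?thesis unfolding is_child_def by blast
  next
    case True
    then have "v \<in> set q" using uv by (simp add: q)
    then obtain a b where q': "q = a @ v # b" by (meson split_list)
    have "is_path ?V ?E (v # b @ [u])"
      using p(1) is_walk_append_iff[of a "v # b @ [u]" ?V ?E]
      by (cases "a = []") (auto simp: q q' is_path_def)
    moreover have "\<not> is_cycle ?V ?E (v # b @ [u])"
      using T by (simp add: is_planar_rooted_tree_def is_tree_def)
    ultimately have "b = []" using e by (auto simp: is_cycle_def Suc_le_eq)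
    then have "p = a @ [v, u]" by (simp add: q q')
    then show ?thesis using p(1,2) unfolding is_child_def by blast
  qed
qed

text \<open>Two parents of \<open>w\<close> would be joined by a path avoiding \<open>w\<close>, which \<open>w\<close> closes to a cycle.\<close>

lemma planar_rooted_tree_parent_unique:
  assumes T: "is_planar_rooted_tree T" and "is_child T u w" "is_child T v w"
  shows "u = v"
proof (rule ccontr)
  assume "u \<noteq> v"
  let ?V = "verts T" and ?E = "edges T"
  \<comment> \<open>Avoiding \<open>w\<close> is expressed by shrinking the vertex set, so joining
    walks and erasing loops preserve it.\<close>
  have walk: "\<exists>p. is_walk (?V - {w}) ?E p \<and> hd p = root T \<and> last p = x \<and> {x, w} \<in> ?E \<and> w \<in> ?V"
    if child: "is_child T x w" for x
  proof -
    obtain p where p: "is_path ?V ?E (p @ [x, w])" "hd (p @ [x, w]) = root T"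
      using child by (auto simp: is_child_def)
    then show ?thesis
      by (intro exI[of _ "p @ [x]"])
         (auto simp: is_path_def is_walk_def successively_append_iff hd_append)
  qed
  obtain p where p: "is_walk (?V - {w}) ?E p" "hd p = root T" "last p = u" "{u, w} \<in> ?E" "w \<in> ?V"
    using walk assms by blast
  obtain q where q: "is_walk (?V - {w}) ?E q" "hd q = root T" "last q = v" "{v, w} \<in> ?E"
    using walk assms by blast
  have pq: "last (rev p) = hd q" using p(2) q(2) by (simp add: last_rev)
  obtain r where r: "is_path (?V - {w}) ?E r" "hd r = u" "last r = v"
    using is_walk_imp_is_path[OF is_walk_join(1)[OF is_walk_rev[OF p(1)] q(1) pq]]
      is_walk_join(2,3)[OF is_walk_rev[OF p(1)] q(1) pq] p(3) q(3)
    by (metis hd_rev)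
  have ne: "r \<noteq> []" using r(1) by (auto simp: is_path_def is_walk_def)
  have "is_path ?V ?E (w # r)"
    using r ne p(4,5) by (auto simp: is_path_def is_walk_def successively_Cons insert_commute)
  moreover have "length (w # r) \<ge> 3"
  proof -
    have "r \<noteq> [x]" for x using r \<open>u \<noteq> v\<close> by auto
    then show ?thesis using ne by (cases r; cases "tl r") auto
  qed
  ultimately have "is_cycle ?V ?E (w # r)" using r q(4) ne by (simp add: is_cycle_def)
  then show False using T by (simp add: is_planar_rooted_tree_def is_tree_def)
qed

text \<open>Read backwards, both paths are forced: the vertex before the last one is its unique
  parent.\<close>

lemma root_path_unique:
  assumes T: "is_planar_rooted_tree T"
    and "is_path (verts T) (edges T) p" "hd p = root T"
    and "is_path (verts T) (edges T) q" "hd q = root T" "last p = last q"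
  shows "p = q"
  using assms(2-)
proof (induction p arbitrary: q rule: rev_induct)
  case Nil
  then show ?case by (simp add: is_path_def is_walk_def)
next
  case (snoc w p)
  have "q \<noteq> []" using snoc.prems by (simp add: is_path_def is_walk_def)
  then obtain q' where q: "q = q' @ [w]"
    using snoc.prems by (metis append_butlast_last_id last_snoc)
  \<comment> \<open>Covers the case that one path is a single vertex: a longer path starting at the
    root cannot end there too.\<close>
  have root_only: "s = []"
    if "is_path (verts T) (edges T) (s @ [root T])" "hd (s @ [root T]) = root T" for s
    using that by (cases s) (auto simp: is_path_def)
  show ?case
  proof (cases "p = [] \<or> q' = []")
    case True
    then have "w = root T" using snoc.prems by (auto simp: q)
    then show ?thesis using root_only snoc.prems unfolding q by metis
  next
    case False
    then obtain p1 u q1 v where p1: "p = p1 @ [u]" and q1: "q' = q1 @ [v]"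
      by (metis rev_exhaust)
    have "is_child T u w" "is_child T v w"
      using snoc.prems by (auto simp: is_child_def q p1 q1)
    then have uv: "u = v" using planar_rooted_tree_parent_unique T by metis
    have "is_path (verts T) (edges T) p" "is_path (verts T) (edges T) q'"
      using snoc.prems False by (auto simp: q is_path_def is_walk_append_iff)
    moreover have "hd p = root T" "hd q' = root T" "last p = last q'"
      using snoc.prems False by (simp_all add: q uv) (simp_all add: p1 q1 uv)
    ultimately have "p = q'" using snoc.IH by blast
    then show ?thesis by (simp add: q)
  qed
qed

text \<open>By uniqueness of root paths, the path to a child is the path to its parent with one more
  vertex; its length therefore grades the tree.\<close>

lemma planar_rooted_tree_graded:
  assumes T: "is_planar_rooted_tree T"
  obtains d where "graded_tree T d"
proof -
  let ?V = "verts T" and ?E = "edges T"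
  have tree: "is_tree ?V ?E" and root: "root T \<in> ?V"
    and kids: "\<And>v. v \<in> ?V \<Longrightarrow> distinct (kids T v)" "\<And>v. v \<in> ?V \<Longrightarrow> set (kids T v) = {w. is_child T v w}"
    using T by (auto simp: is_planar_rooted_tree_def)
  have "\<exists>p. is_path ?V ?E p \<and> hd p = root T \<and> last p = v" if v: "v \<in> ?V" for v
  proof -
    obtain w where "is_walk ?V ?E w" "hd w = root T" "last w = v"
      using tree root v unfolding is_tree_def is_connected_def by blast
    then show ?thesis by (metis is_walk_imp_is_path)
  qed
  then obtain P where P: "\<And>v. v \<in> ?V \<Longrightarrow> is_path ?V ?E (P v) \<and> hd (P v) = root T \<and> last (P v) = v"
    by metis
  have child: "v \<in> ?V \<and> w \<in> ?V \<and> {v, w} \<in> ?E \<and> P w = P v @ [w] \<and> P v \<noteq> []" if child: "is_child T v w" for v w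
  proof -
    obtain p where p: "is_path ?V ?E (p @ [v, w])" "hd (p @ [v, w]) = root T"
      using child by (auto simp: is_child_def)
    have V: "v \<in> ?V" "w \<in> ?V" "{v, w} \<in> ?E"
      using p by (auto simp: is_path_def is_walk_def successively_append_iff)
    have "is_path ?V ?E (p @ [v])" "hd (p @ [v]) = root T"
      using p by (auto simp: is_path_def is_walk_def successively_append_iff hd_append)
    then have "P v = p @ [v]" using root_path_unique[OF T] P[OF V(1)] by simp
    moreover have "P w = p @ [v, w]" using root_path_unique[OF T] P[OF V(2)] p by simp
    ultimately show ?thesis using V by simp
  qed
  have Proot: "P (root T) = [root T]"
    using root_path_unique[OF T, of "P (root T)" "[root T]"] P[OF root] root by (simp add: is_path_def)
  \<comment> \<open>Subtracting 1 counts edges instead of vertices, so that the root gets depth 0.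
    The paths are nonempty, so the subtraction does not truncate.\<close>
  have "graded_tree T (\<lambda>v. length (P v) - 1)"
  proof
    show "finite ?V" using tree by (simp add: is_tree_def)
    show "root T \<in> ?V" by fact
    show "length (P (root T)) - 1 = 0" by (simp add: Proot)
    show "distinct (kids T v)" if "v \<in> ?V" for v using kids that by simp
    show "w \<in> ?V" if "v \<in> ?V" "w \<in> set (kids T v)" for v w using that kids child by auto
    show "length (P w) - 1 = Suc (length (P v) - 1)" if "v \<in> ?V" "w \<in> set (kids T v)" for v w
    proof -
      have "P w = P v @ [w]" "P v \<noteq> []" using that kids child by auto
      then show ?thesis by (cases "P v") auto
    qed
    show "u = v" if "u \<in> ?V" "v \<in> ?V" "w \<in> set (kids T u)" "w \<in> set (kids T v)" for u v w
      using that kids planar_rooted_tree_parent_unique[OF T] by blast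
    show "\<exists>v\<in>?V. w \<in> set (kids T v)" if w: "w \<in> ?V" "w \<noteq> root T" for w
    proof -
      have path: "is_path ?V ?E (P w)" "hd (P w) = root T" "last (P w) = w" using P w by auto
      then obtain q where q: "P w = q @ [w]"
        by (metis append_butlast_last_id is_path_def is_walk_def)
      then have "q \<noteq> []" using path w by auto
      then obtain p v where "q = p @ [v]" by (metis rev_exhaust)
      then have "is_child T v w" using path q by (auto simp: is_child_def)
      then show ?thesis using child kids by blast
    qed
    show "?E = {{v, w} | v w. v \<in> ?V \<and> w \<in> set (kids T v)}"
    proof (intro equalityI subsetI)
      fix e assume e: "e \<in> ?E"
      obtain u v where uv: "e = {u, v}"
        using tree e is_graph_edgeE unfolding is_tree_def by metis
      then have "is_child T u v \<or> is_child T v u"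
        using planar_rooted_tree_edge_cases T e by metis
      then obtain x y where xy: "e = {x, y}" "is_child T x y"
        using uv by (metis insert_commute)
      then have "x \<in> ?V" "y \<in> set (kids T x)" using child kids by auto
      with xy(1) show "e \<in> {{v, w} | v w. v \<in> ?V \<and> w \<in> set (kids T v)}" by blast
    qed (use kids child in auto)
  qed
  then show thesis by (rule that)
qed

section \<open>Canonical representatives\<close>

datatype plane_tree = Node (subtrees: "plane_tree list")

fun edge_count :: "plane_tree \<Rightarrow> nat" where
  "edge_count (Node ts) = (\<Sum>t\<leftarrow>ts. Suc (edge_count t))"

text \<open>A vertex is addressed by the positions of the children chosen on the way from the root.\<close>

primrec subtree_at :: "plane_tree \<Rightarrow> nat list \<Rightarrow> plane_tree" where
  "subtree_at t [] = t"
| "subtree_at t (i # a) = subtree_at (subtrees t ! i) a"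

primrec is_address :: "plane_tree \<Rightarrow> nat list \<Rightarrow> bool" where
  "is_address t [] \<longleftrightarrow> True"
| "is_address t (i # a) \<longleftrightarrow> i < length (subtrees t) \<and> is_address (subtrees t ! i) a"

lemma subtree_at_append [simp]: "subtree_at t (a @ b) = subtree_at (subtree_at t a) b"
  by (induction a arbitrary: t) auto

lemma is_address_append [simp]:
  "is_address t (a @ b) \<longleftrightarrow> is_address t a \<and> is_address (subtree_at t a) b"
  by (induction a arbitrary: t) auto

lemma addresses_Node:
  "Collect (is_address (Node ts)) =
    insert [] (\<Union>i\<in>{0..<length ts}. (#) i ` Collect (is_address (ts ! i)))" (is "?L = ?R")
proof (rule set_eqI)
  fix a show "a \<in> ?L \<longleftrightarrow> a \<in> ?R" by (cases a) auto
qed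

text \<open>The addresses starting with \<open>i\<close> belong to the \<open>i\<close>th subtree,
  and their number is its summand in \<open>edge_count\<close>: the edges inside that subtree and
  the one leading to it. The empty address accounts for the outer \<open>Suc\<close>.\<close>

lemma finite_addresses: "finite (Collect (is_address t))"
  and card_addresses: "card (Collect (is_address t)) = Suc (edge_count t)"
proof (induction t)
  case (Node ts)
  let ?A = "\<lambda>i. (#) i ` Collect (is_address (ts ! i))"
  have fin: "finite (?A i)" and card: "card (?A i) = Suc (edge_count (ts ! i))"
    if "i \<in> {0..<length ts}" for i
    using Node[of "ts ! i"] that by (auto simp: card_image)
  have finU: "finite (\<Union>i\<in>{0..<length ts}. ?A i)" using fin by blast
  then show "finite (Collect (is_address (Node ts)))" by (simp add: addresses_Node)
  have "card (\<Union>i\<in>{0..<length ts}. ?A i) = (\<Sum>i\<in>{0..<length ts}. card (?A i))"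
    using fin by (intro card_UN_disjoint) auto
  also have "\<dots> = edge_count (Node ts)"
    using card by (simp add: sum_list_sum_nth)
  finally show "card (Collect (is_address (Node ts))) = Suc (edge_count (Node ts))"
    using finU by (subst addresses_Node, subst card_insert_disjoint) auto
qed

text \<open>Addresses are coded as natural numbers because the quotient type is built from trees
  with natural numbers as vertices. An edge is indexed by the address of its lower end.\<close>

definition canonical :: "plane_tree \<Rightarrow> nat tree_data" where
  "canonical t =
    \<lparr>verts = list_encode ` Collect (is_address t),
     edges = {{list_encode a, list_encode (a @ [i])} | a i. is_address t (a @ [i])},
     root = list_encode [],
     kids = (\<lambda>v. map (\<lambda>i. list_encode (list_decode v @ [i]))
       [0..<length (subtrees (subtree_at t (list_decode v)))])\<rparr>"

lemma set_kids_canonical: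
  "set (kids (canonical t) (list_encode a)) =
    {list_encode (a @ [i]) | i. i < length (subtrees (subtree_at t a))}"
  by (auto simp: canonical_def)

lemma verts_canonical: "verts (canonical t) = list_encode ` Collect (is_address t)"
  by (simp add: canonical_def)

text \<open>Dropping the last entry of an address gives the parent, so parents are unique and the
  address length is the depth.\<close>

lemma graded_tree_canonical: "graded_tree (canonical t) (\<lambda>v. length (list_decode v))"
proof
  show "finite (verts (canonical t))" by (simp add: verts_canonical finite_addresses)
  show "root (canonical t) \<in> verts (canonical t)"
    by (auto simp: canonical_def simp del: list_encode.simps)
  show "length (list_decode (root (canonical t))) = 0"
    unfolding canonical_def tree_data.simps list_encode_inverse by simp
  show "distinct (kids (canonical t) v)" for v
    by (auto simp: canonical_def distinct_map inj_on_def list_encode_eq)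
  show "w \<in> verts (canonical t)"
    if "v \<in> verts (canonical t)" "w \<in> set (kids (canonical t) v)" for v w
    using that by (auto simp: verts_canonical set_kids_canonical)
  show "length (list_decode w) = Suc (length (list_decode v))"
    if "v \<in> verts (canonical t)" "w \<in> set (kids (canonical t) v)" for v w
    using that by (auto simp: verts_canonical set_kids_canonical)
  show "u = v"
    if "u \<in> verts (canonical t)" "v \<in> verts (canonical t)"
      "w \<in> set (kids (canonical t) u)" "w \<in> set (kids (canonical t) v)" for u v w
    using that by (auto simp: verts_canonical set_kids_canonical list_encode_eq)
  show "\<exists>v\<in>verts (canonical t). w \<in> set (kids (canonical t) v)"
    if w: "w \<in> verts (canonical t)" "w \<noteq> root (canonical t)" for w
  proof -
    obtain a where a: "w = list_encode a" "is_address t a"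
      using w(1) by (auto simp: verts_canonical)
    moreover have "a \<noteq> []" using w(2) a by (auto simp: canonical_def)
    ultimately obtain b i where "a = b @ [i]" by (metis rev_exhaust)
    then show ?thesis using a
      by (intro bexI[of _ "list_encode b"]) (auto simp: verts_canonical set_kids_canonical)
  qed
  show "edges (canonical t) =
    {{v, w} | v w. v \<in> verts (canonical t) \<and> w \<in> set (kids (canonical t) v)}" (is "_ = ?R")
  proof -
    have "?R = {{list_encode a, w} | a w. is_address t a \<and> w \<in> set (kids (canonical t) (list_encode a))}"
      by (auto simp: verts_canonical)
    also have "\<dots> = {{list_encode a, list_encode (a @ [i])} | a i. is_address t (a @ [i])}"
      unfolding set_kids_canonical by auto
    finally show ?thesis by (simp add: canonical_def)
  qed
qed

lemma card_edges_canonical: "card (edges (canonical t)) = edge_count t"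
proof -
  have "card (verts (canonical t)) = Suc (edge_count t)"
    by (simp add: verts_canonical card_image inj_list_encode card_addresses)
  then show ?thesis using graded_tree.card_edges[OF graded_tree_canonical, of t] by simp
qed

text \<open>A labelling assigns to each vertex the plane tree of its descendants; it is the invariant
  that separates isomorphism classes.\<close>

definition is_labelling :: "'a tree_data \<Rightarrow> ('a \<Rightarrow> plane_tree) \<Rightarrow> bool" where
  "is_labelling T \<sigma> \<longleftrightarrow> (\<forall>v\<in>verts T. \<sigma> v = Node (map \<sigma> (kids T v)))"

lemma is_labelling_canonical: "is_labelling (canonical t) (\<lambda>v. subtree_at t (list_decode v))"
proof -
  have "s = Node (map (\<lambda>i. subtrees s ! i) [0..<length (subtrees s)])" for s
    by (simp add: map_nth)
  then show ?thesis by (auto simp: is_labelling_def canonical_def comp_def)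
qed

text \<open>Isomorphisms carry child lists to child lists in order, so labellings pull back.
  Together with \<open>labelling_unique\<close> this makes the label of the root an isomorphism
  invariant.\<close>

lemma is_labelling_iso:
  assumes "is_iso f S T" "is_labelling T \<sigma>"
  shows "is_labelling S (\<sigma> \<circ> f)"
  unfolding is_labelling_def
proof
  fix v assume v: "v \<in> verts S"
  then have "f v \<in> verts T" "map f (kids S v) = kids T (f v)"
    using assms(1) by (auto simp: is_iso_def bij_betw_def)
  then show "(\<sigma> \<circ> f) v = Node (map (\<sigma> \<circ> f) (kids S v))"
    using assms(2) by (metis comp_apply is_labelling_def map_map)
qed

text \<open>The number is fuel: recursion along arbitrary child lists need not terminate.\<close>

fun unfold_kids :: "('a \<Rightarrow> 'a list) \<Rightarrow> nat \<Rightarrow> 'a \<Rightarrow> plane_tree" where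
  "unfold_kids ks 0 v = Node []"
| "unfold_kids ks (Suc n) v = Node (map (unfold_kids ks n) (ks v))"

primrec vertex_at :: "'a tree_data \<Rightarrow> 'a \<Rightarrow> nat list \<Rightarrow> 'a" where
  "vertex_at T v [] = v"
| "vertex_at T v (i # a) = vertex_at T (kids T v ! i) a"

lemma vertex_at_append [simp]: "vertex_at T v (a @ b) = vertex_at T (vertex_at T v a) b"
  by (induction a arbitrary: v) auto

context graded_tree
begin

lemma labelling_exists: "\<exists>\<sigma>. is_labelling T \<sigma>"
proof -
  define N where "N = Max (d ` verts T)"
  \<comment> \<open>The fuel is positive at every vertex and drops by one towards each child,
    exactly as the depth grows, so the default \<open>Node []\<close> is never reached.\<close>
  have "is_labelling T (\<lambda>v. unfold_kids (kids T) (Suc N - d v) v)"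
    unfolding is_labelling_def
  proof
    fix v assume v: "v \<in> verts T"
    then have "d v \<le> N" using finite_verts by (simp add: N_def)
    then have "Suc N - d v = Suc (N - d v)" by simp
    then show "unfold_kids (kids T) (Suc N - d v) v =
        Node (map (\<lambda>v. unfold_kids (kids T) (Suc N - d v) v) (kids T v))"
      using depth_kid[OF v] by simp
  qed
  then show ?thesis by blast
qed

text \<open>The labelling equation forces \<open>Node []\<close> at a leaf, and elsewhere the labels
  of the children force the label of the vertex.\<close>

lemma labelling_unique:
  assumes "is_labelling T \<sigma>" "is_labelling T \<tau>" "v \<in> verts T"
  shows "\<sigma> v = \<tau> v"
  using assms(3)
proof (induction rule: leaf_induct)
  case (vert v)
  then have "map \<sigma> (kids T v) = map \<tau> (kids T v)" by simp
  then show ?case using assms(1,2) vert(1) by (metis is_labelling_def)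
qed

text \<open>The subtrees of a label correspond position by position to the children, so an address
  that is valid in the label can be followed in the tree.\<close>

lemma
  assumes "is_labelling T \<sigma>" "v \<in> verts T" "is_address (\<sigma> v) a"
  shows vertex_at_in_verts: "vertex_at T v a \<in> verts T"
    and label_vertex_at: "\<sigma> (vertex_at T v a) = subtree_at (\<sigma> v) a"
    and depth_vertex_at: "d (vertex_at T v a) = d v + length a"
proof -
  have "vertex_at T v a \<in> verts T \<and> \<sigma> (vertex_at T v a) = subtree_at (\<sigma> v) a \<and>
      d (vertex_at T v a) = d v + length a"
    using assms(2,3)
  proof (induction a arbitrary: v)
    case (Cons i a)
    have \<sigma>v: "subtrees (\<sigma> v) = map \<sigma> (kids T v)"
      using assms(1) Cons.prems(1) by (metis is_labelling_def plane_tree.sel)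
    then have i: "i < length (kids T v)" "is_address (\<sigma> (kids T v ! i)) a"
      using Cons.prems(2) by auto
    then have "kids T v ! i \<in> verts T" "d (kids T v ! i) = Suc (d v)"
      using Cons.prems(1) kid_in_verts depth_kid by auto
    then show ?case using Cons.IH[of "kids T v ! i"] i \<sigma>v by simp
  qed simp
  then show "vertex_at T v a \<in> verts T" "\<sigma> (vertex_at T v a) = subtree_at (\<sigma> v) a"
    "d (vertex_at T v a) = d v + length a" by auto
qed

text \<open>The isomorphism follows each address of the root's label from the root of
  \<open>T\<close>.\<close>

lemma canonical_iso:
  assumes \<sigma>: "is_labelling T \<sigma>"
  shows "is_iso (\<lambda>x. vertex_at T (root T) (list_decode x)) (canonical (\<sigma> (root T))) T"
proof (rule is_iso_graded_treeI[OF graded_tree_canonical graded_tree_axioms])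
  let ?t = "\<sigma> (root T)" and ?f = "vertex_at T (root T)"
  note at = vertex_at_in_verts[OF \<sigma> root_in_verts] label_vertex_at[OF \<sigma> root_in_verts]
    depth_vertex_at[OF \<sigma> root_in_verts]
  have arity: "length (subtrees (\<sigma> v)) = length (kids T v)" if "v \<in> verts T" for v
    using \<sigma> that by (metis is_labelling_def length_map plane_tree.sel)
  \<comment> \<open>Equal end vertices have equal depth, hence addresses of equal length. Unique
    parents then identify the vertices one step up, and distinctness of the child list identifies
    the last position.\<close>
  have inj: "a = b" if "is_address ?t a" "is_address ?t b" "?f a = ?f b" for a b
    using that
  proof (induction a arbitrary: b rule: rev_induct)
    case Nil
    then have "length b = 0" using at(3)[of b] at(3)[of "[]"] by simp
    then show ?case by simp
  next
    case (snoc i a)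
    have "length b = Suc (length a)"
      using at(3)[of b] at(3)[of "a @ [i]"] snoc.prems by simp
    then obtain c j where b: "b = c @ [j]" by (metis length_Suc_conv_rev)
    have ac: "is_address ?t a" "is_address ?t c" using snoc.prems by (auto simp: b)
    have ij: "i < length (kids T (?f a))" "j < length (kids T (?f c))"
      using snoc.prems at(2) arity at(1) ac by (metis b is_address.simps(2) is_address_append)+
    have eq: "kids T (?f a) ! i = kids T (?f c) ! j" using snoc.prems by (simp add: b)
    then have "?f a = ?f c"
      using parent_unique[OF at(1)[OF ac(1)] at(1)[OF ac(2)]] ij by (metis nth_mem)
    moreover from this have "a = c" using snoc.IH ac by blast
    ultimately show ?case
      using eq ij distinct_kids[OF at(1)[OF ac(1)]] by (simp add: b nth_eq_iff_index_eq)
  qed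
  have surj: "\<exists>a. is_address ?t a \<and> ?f a = v" if "v \<in> verts T" for v
    using that
  proof (induction rule: root_induct)
    case root
    show ?case by (rule exI[of _ "[]"]) simp
  next
    case (kid v w)
    then obtain a where a: "is_address ?t a" "?f a = v" by blast
    obtain i where i: "i < length (kids T v)" "w = kids T v ! i"
      using kid(2) by (metis in_set_conv_nth)
    have "is_address ?t (a @ [i])" using a i at(2)[OF a(1)] arity[OF kid(1)] by simp
    then show ?case using a i by (intro exI[of _ "a @ [i]"]) simp
  qed
  show "bij_betw (\<lambda>x. ?f (list_decode x)) (verts (canonical ?t)) (verts T)"
    unfolding bij_betw_def
  proof
    show "inj_on (\<lambda>x. ?f (list_decode x)) (verts (canonical ?t))"
      using inj by (auto simp: verts_canonical inj_on_def)
    show "(\<lambda>x. ?f (list_decode x)) ` verts (canonical ?t) = verts T"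
      using surj at(1) by (force simp: verts_canonical image_image)
  qed
  show "?f (list_decode (root (canonical ?t))) = root T"
    unfolding canonical_def tree_data.simps list_encode_inverse by simp
  show "map (\<lambda>x. ?f (list_decode x)) (kids (canonical ?t) x) = kids T (?f (list_decode x))"
    if x: "x \<in> verts (canonical ?t)" for x
  proof -
    obtain a where a: "x = list_encode a" "is_address ?t a"
      using x by (auto simp: verts_canonical)
    have "length (subtrees (subtree_at ?t a)) = length (kids T (?f a))"
      using at(1,2)[OF a(2)] arity by metis
    then show ?thesis by (simp add: canonical_def a(1) comp_def map_nth)
  qed
qed

end

section \<open>Counting\<close>

definition planar_tree_of :: "plane_tree \<Rightarrow> planar_tree" where
  "planar_tree_of t = abs_planar_tree (canonical t)"

lemma planar_rooted_tree_canonical: "is_planar_rooted_tree (canonical t)"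
  using graded_tree.planar_rooted_tree graded_tree_canonical by blast

text \<open>The labelling of the second tree, pulled back along the isomorphism, must agree with
  that of the first. At the roots the labels are \<open>t\<close> and \<open>s\<close>
  themselves.\<close>

lemma isomorphic_canonical_imp_eq:
  assumes "isomorphic (canonical s) (canonical t)"
  shows "s = t"
proof -
  obtain f where f: "is_iso f (canonical s) (canonical t)"
    using assms unfolding isomorphic_def by blast
  let ?\<sigma> = "\<lambda>v. subtree_at s (list_decode v)" and ?\<tau> = "\<lambda>v. subtree_at t (list_decode v)"
  let ?r = "list_encode []"
  have r: "root (canonical u) = ?r" for u by (simp add: canonical_def)
  then have "?r \<in> verts (canonical s)"
    using graded_tree.root_in_verts[OF graded_tree_canonical] by metis
  then have "?\<sigma> ?r = (?\<tau> \<circ> f) ?r"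
    using graded_tree.labelling_unique[OF graded_tree_canonical] is_labelling_canonical
      is_labelling_iso[OF f] by metis
  moreover have "f ?r = ?r" using f r by (simp only: is_iso_def)
  ultimately show ?thesis
    by (simp only: comp_apply list_encode_inverse subtree_at.simps)
qed

lemma bij_planar_tree_of: "bij planar_tree_of"
proof (rule bijI)
  show "inj planar_tree_of"
  proof (rule injI)
    fix s t assume "planar_tree_of s = planar_tree_of t"
    \<comment> \<open>Since the equivalence is partial, equal classes give an isomorphism only
      between representatives known to be planar rooted trees.\<close>
    then have "isomorphic (canonical s) (canonical t)"
      using Quotient3_rel[OF Quotient3_planar_tree] isomorphic_refl planar_rooted_tree_canonical
      unfolding planar_tree_of_def by metis
    then show "s = t" by (rule isomorphic_canonical_imp_eq)
  qed
  have "T \<in> range planar_tree_of" for T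
  proof (induction T rule: planar_tree.abs_induct)
    case (1 T)
    then have T: "is_planar_rooted_tree T" by (simp add: isomorphic_def)
    then obtain d where "graded_tree T d" by (rule planar_rooted_tree_graded)
    then interpret graded_tree T d .
    obtain \<sigma> where "is_labelling T \<sigma>" using labelling_exists by blast
    then have "isomorphic (canonical (\<sigma> (root T))) T"
      using canonical_iso T planar_rooted_tree_canonical unfolding isomorphic_def by blast
    then have "planar_tree_of (\<sigma> (root T)) = abs_planar_tree T"
      unfolding planar_tree_of_def by (rule Quotient3_rel_abs[OF Quotient3_planar_tree])
    then show ?case by (metis rangeI)
  qed
  then show "surj planar_tree_of" by blast
qed

lemma num_edges_planar_tree_of: "num_edges (planar_tree_of t) = edge_count t"
  unfolding planar_tree_of_def
  using num_edges.abs_eq[OF isomorphic_refl[OF planar_rooted_tree_canonical]] card_edges_canonical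
  by simp

section \<open>Convolution as a count of pairs\<close>

text \<open>Serves both the Catalan recursion and the recursion for forests. Disjointness of the
  first factors is enough, since the first component of a pair then determines
  \<open>i\<close>.\<close>

lemma
  assumes "\<And>i. i \<le> n \<Longrightarrow> finite (X i)" "\<And>i. i \<le> n \<Longrightarrow> finite (Y i)"
    and "\<And>i j. i \<noteq> j \<Longrightarrow> X i \<inter> X j = {}"
  shows finite_convolution: "finite (\<Union>i\<le>n. X i \<times> Y (n - i))"
    and card_convolution: "card (\<Union>i\<le>n. X i \<times> Y (n - i)) =
      convolution (\<lambda>i. card (X i)) (\<lambda>i. card (Y i)) n"
proof -
  show "finite (\<Union>i\<le>n. X i \<times> Y (n - i))" using assms(1,2) by simp
  have "card (\<Union>i\<le>n. X i \<times> Y (n - i)) = (\<Sum>i\<le>n. card (X i \<times> Y (n - i)))"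
  proof (intro card_UN_disjoint ballI impI)
    show "X i \<times> Y (n - i) \<inter> X j \<times> Y (n - j) = {}" if "i \<noteq> j" for i j
      using assms(3)[OF that] by blast
  qed (use assms(1,2) in auto)
  then show "card (\<Union>i\<le>n. X i \<times> Y (n - i)) = convolution (\<lambda>i. card (X i)) (\<lambda>i. card (Y i)) n"
    by (simp add: convolution_def card_cartesian_product)
qed

text \<open>Removing the leftmost subtree of the root splits a tree with \<open>n + 1\<close> edges into two trees
  with \<open>n\<close> edges in total.\<close>

lemma edge_count_Suc_eq:
  "{t. edge_count t = Suc n} =
    (\<lambda>(s, t). Node (s # subtrees t)) `
      (\<Union>i\<le>n. {t. edge_count t = i} \<times> {t. edge_count t = n - i})" (is "?L = ?R")
proof (intro equalityI subsetI)
  fix t assume "t \<in> ?L"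
  then obtain s ts where t: "t = Node (s # ts)" "edge_count s + edge_count (Node ts) = n"
    by (cases t; cases "subtrees t") auto
  then show "t \<in> ?R" by (force intro!: image_eqI[of _ _ "(s, Node ts)"])
next
  have "edge_count (Node (s # subtrees t)) = Suc (edge_count s + edge_count t)" for s t
    by (cases t) simp
  then show "t \<in> ?L" if "t \<in> ?R" for t using that by auto
qed

text \<open>The Catalan recursion reaches back to all smaller indices, hence the strong induction;
  finiteness is carried along because the count of pairs relies on it.\<close>

lemma card_plane_trees:
  "finite {t. edge_count t = n} \<and> card {t. edge_count t = n} = catalan n"
proof (induction n rule: less_induct)
  case (less n)
  show ?case
  proof (cases n)
    case 0
    have "edge_count t = 0 \<longleftrightarrow> t = Node []" for t
      by (cases t) (auto simp: neq_Nil_conv)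
    then show ?thesis by (simp add: 0)
  next
    case (Suc m)
    let ?X = "\<lambda>i. {t. edge_count t = i}"
    have IH: "finite (?X i)" "card (?X i) = catalan i" if "i \<le> m" for i
      using less[of i] that by (simp_all add: Suc)
    let ?P = "\<Union>i\<le>m. ?X i \<times> ?X (m - i)"
    have fin: "finite ?P" by (rule finite_convolution) (use IH in auto)
    have "card ?P = convolution (\<lambda>i. card (?X i)) (\<lambda>i. card (?X i)) m"
      by (rule card_convolution) (use IH in auto)
    also have "\<dots> = catalan n" using IH by (simp add: convolution_def Suc)
    finally have "card ?P = catalan n" .
    \<comment> \<open>A plane tree is recovered from its list of subtrees.\<close>
    moreover have "inj_on (\<lambda>(s, t). Node (s # subtrees t)) ?P"
      by (auto simp: inj_on_def plane_tree.expand)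
    ultimately show ?thesis using fin unfolding Suc edge_count_Suc_eq by (simp add: card_image)
  qed
qed

lemma card_planar_trees:
  "finite {T. num_edges T = n} \<and> card {T. num_edges T = n} = catalan n"
proof -
  have "{T. num_edges T = n} = planar_tree_of ` {t. edge_count t = n}"
  proof (intro equalityI subsetI)
    fix T assume T: "T \<in> {T. num_edges T = n}"
    obtain t where "T = planar_tree_of t" using bij_planar_tree_of by (metis bij_pointE)
    then show "T \<in> planar_tree_of ` {t. edge_count t = n}"
      using T by (simp add: num_edges_planar_tree_of)
  qed (auto simp: num_edges_planar_tree_of)
  moreover have "inj_on planar_tree_of {t. edge_count t = n}"
    using bij_planar_tree_of by (meson bij_is_inj inj_on_subset subset_UNIV)
  ultimately show ?thesis using card_plane_trees by (simp add: card_image)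
qed

lemma planar_forests_1: "planar_forests (Suc 0) n = (\<lambda>T. [T]) ` {T. num_edges T = n}"
  by (auto simp: planar_forests_def length_Suc_conv)

lemma planar_forests_Suc:
  "planar_forests (Suc m) n =
    (\<lambda>(T, F). T # F) ` (\<Union>i\<le>n. {T. num_edges T = i} \<times> planar_forests m (n - i))"
  by (force simp: planar_forests_def length_Suc_conv)

theorem theorem4p7:
  fixes k n :: nat
  shows "finite (planar_forests (k + 1) n) \<and>
         card (planar_forests (k + 1) n) = self_convolution catalan k n"
proof (induction k arbitrary: n)
  \<comment> \<open>Because of the index shift, the base case is a forest with a single tree and the
    sequence \<open>catalan\<close> itself.\<close>
  case 0
  show ?case using card_planar_trees[of n] by (simp add: planar_forests_1 card_image inj_on_def)
next
  case (Suc k)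
  let ?X = "\<lambda>i. {T. num_edges T = i}" and ?Y = "planar_forests (Suc k)"
  let ?P = "\<Union>i\<le>n. ?X i \<times> ?Y (n - i)"
  have IH: "finite (?Y i)" "card (?Y i) = self_convolution catalan k i" for i
    using Suc[of i] by simp_all
  have fin: "finite ?P" by (rule finite_convolution) (use IH card_planar_trees in auto)
  have "card ?P = convolution (\<lambda>i. card (?X i)) (\<lambda>i. card (?Y i)) n"
    by (rule card_convolution) (use IH card_planar_trees in auto)
  also have "\<dots> = self_convolution catalan (Suc k) n"
    using IH card_planar_trees by (simp add: convolution_def)
  finally have "card ?P = self_convolution catalan (Suc k) n" .
  moreover have "inj_on (\<lambda>(T, F). T # F) ?P" by (auto simp: inj_on_def)
  ultimately show ?case
    using fin planar_forests_Suc[of "Suc k" n] by (simp add: card_image)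
qed

end
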